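(* Local $2$-WL, denoted $2$-WL$_L$, has equivalent link discriminating power to $1$-WL. That is: for all finite undirected node-labeled graphs $G=(V,E,l)$, $G'=(V',E',l')$ and all target links $e\in V\times V$, $e'\in V'\times V'$, the test $2$-WL$_L$ distinguishes $(e,G)$ and $(e',G')$ if and only if $1$-WL distinguishes $(e,G)$ and $(e',G')$.
   Context: Graphs. A labeled graph is $G=(V,E,l)$ with finite node set $V=[n]=\{1,\dots,n\}$, edge set $E\subseteq V\times V$ (undirected, i.e. $E$ is symmetric), and $l:V\to\Sigma$ a node labeling in a label set $\Sigma$. $N(v)$ denotes the set of neighbors of $v$. A link is an ordered pair $e=(p,q)\in V\times V$. Multisets are written $\{\!\!\{\cdot\}\!\!\}$. Standing assumption. The target links being compared have unknown edge status: their edge-existence indicator is set to $0$, i.e. target links $e=(p,q)$ in $G$ and $e'=(p',q')$ in $G'$ satisfy $e\notin E$, $e'\notin E'$ (the target link is not part of the observed graph). $1$-WL. $c^{(0)}(v)=l(v)$ and $c^{(t)}(v)=f\big(c^{(t-1)}(v),\{\!\!\{c^{(t-1)}(u): u\in N(v)\}\!\!\}\big)$ for $t\ge 1$, with $f$ a fixed injective function (the same for all graphs). $1$-WL distinguishes $(e,G)$ and $(e',G')$ unless $c^{(t)}(p)=c^{(t)}(p')$ and $c^{(t)}(q)=c^{(t)}(q')$ for all $t\ge 0$. Local $2$-WL ($2$-WL$_L$). Colors are assigned to all pairs in $V\times V$: $c^{(0)}(p,q)=\big(l(p),l(q),\mathbf 1[(p,q)\in E]\big)$ and, for $t\ge1$,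 $$c^{(t)}(p,q)=f\Big(c^{(t-1)}(p,q),\ \{\!\!\{c^{(t-1)}(u,q): u\in V,\,(u,q)\in E\}\!\!\},\ \{\!\!\{c^{(t-1)}(p,v): v\in V,\,(p,v)\in E\}\!\!\}\Big),$$ with $f$ a fixed injective function (the same for all graphs). $2$-WL$_L$ distinguishes $(e,G)$ and $(e',G')$ unless $c^{(t)}(e)=c^{(t)}(e')$ for all $t\ge0$. *)

theory Defs
  imports Main "HOL-Library.Multiset"
begin

text \<open>
  A labeled graph has node set \<open>{1..n}\<close>. The label set \<open>\<Sigma>\<close> is the type \<open>'l\<close>; only the values of
  the labeling on \<open>{1..n}\<close> are ever used. Self-loops are allowed.
\<close>

record 'l lgraph =
  num_nodes :: nat
  edges :: "(nat \<times> nat) set"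
  label :: "nat \<Rightarrow> 'l"

definition nodes :: "'l lgraph \<Rightarrow> nat set" where
  "nodes G = {1..num_nodes G}"

definition labeled_graph :: "'l lgraph \<Rightarrow> bool" where
  "labeled_graph G \<longleftrightarrow> edges G \<subseteq> nodes G \<times> nodes G \<and> sym (edges G)"

definition neighbors :: "'l lgraph \<Rightarrow> nat \<Rightarrow> nat set" where
  "neighbors G v = {u \<in> nodes G. (u, v) \<in> edges G}"

text \<open>
  The colors form a type \<open>'c\<close>. The initial colors (labels, respectively triples of two labels and
  an edge indicator) are regarded as elements of \<open>'c\<close> through a map \<open>\<iota>\<close>, and \<open>f\<close> is the update
  function. Both are meant to be injective, which is assumed where the tests are used. The images
  of \<open>\<iota>\<close> and \<open>f\<close> may overlap: colors are only compared at equal rounds.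
\<close>

fun wl1 ::
  "('l \<Rightarrow> 'c) \<Rightarrow> ('c \<times> 'c multiset \<Rightarrow> 'c) \<Rightarrow> 'l lgraph \<Rightarrow> nat \<Rightarrow> nat \<Rightarrow> 'c"
where
  "wl1 \<iota> f G 0 v = \<iota> (label G v)"
| "wl1 \<iota> f G (Suc t) v =
     f (wl1 \<iota> f G t v, {# wl1 \<iota> f G t u. u \<in># mset_set (neighbors G v) #})"

definition wl1_distinguishes ::
  "('l \<Rightarrow> 'c) \<Rightarrow> ('c \<times> 'c multiset \<Rightarrow> 'c) \<Rightarrow>
   (nat \<times> nat) \<Rightarrow> 'l lgraph \<Rightarrow> (nat \<times> nat) \<Rightarrow> 'l lgraph \<Rightarrow> bool"
where
  "wl1_distinguishes \<iota> f e G e' G' \<longleftrightarrow>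
     \<not> (\<forall>t. wl1 \<iota> f G t (fst e) = wl1 \<iota> f G' t (fst e') \<and>
            wl1 \<iota> f G t (snd e) = wl1 \<iota> f G' t (snd e'))"

fun wl2_local ::
  "('l \<times> 'l \<times> bool \<Rightarrow> 'c) \<Rightarrow> ('c \<times> 'c multiset \<times> 'c multiset \<Rightarrow> 'c) \<Rightarrow>
   'l lgraph \<Rightarrow> nat \<Rightarrow> nat \<times> nat \<Rightarrow> 'c"
where
  "wl2_local \<iota> f G 0 (p, q) = \<iota> (label G p, label G q, (p, q) \<in> edges G)"
| "wl2_local \<iota> f G (Suc t) (p, q) =
     f (wl2_local \<iota> f G t (p, q),
        {# wl2_local \<iota> f G t (u, q). u \<in># mset_set {u \<in> nodes G. (u, q) \<in> edges G} #},
        {# wl2_local \<iota> f G t (p, v). v \<in># mset_set {v \<in> nodes G. (p, v) \<in> edges G} #})"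

definition wl2_local_distinguishes ::
  "('l \<times> 'l \<times> bool \<Rightarrow> 'c) \<Rightarrow> ('c \<times> 'c multiset \<times> 'c multiset \<Rightarrow> 'c) \<Rightarrow>
   (nat \<times> nat) \<Rightarrow> 'l lgraph \<Rightarrow> (nat \<times> nat) \<Rightarrow> 'l lgraph \<Rightarrow> bool"
where
  "wl2_local_distinguishes \<iota> f e G e' G' \<longleftrightarrow>
     \<not> (\<forall>t. wl2_local \<iota> f G t e = wl2_local \<iota> f G' t e')"

text \<open>
  Injective update functions exist only on infinite color types. For every label type the color
  types freely generated by the initial colors and the updates provide instances.
\<close>

datatype 'l color1 = Init1 'l | Update1 "'l color1 \<times> 'l color1 multiset"

datatype 'l color2 =
  Init2 "'l \<times> 'l \<times> bool" | Update2 "'l color2 \<times> 'l color2 multiset \<times> 'l color2 multiset"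

lemma inj_color1: "inj Init1" "inj Update1"
  by (auto intro: injI)

lemma inj_color2: "inj Init2" "inj Update2"
  by (auto intro: injI)

end

theory Submission
  imports Defs
begin

text \<open>
  At every round, the local 2-WL color of a pair carries exactly the 1-WL colors of its two
  components together with the edge indicator. The update of \<open>(p, q)\<close> only inspects pairs
  \<open>(u, q)\<close> and \<open>(p, v)\<close> that are edges, so their indicator is constant and the two multisets amount
  to the multisets of 1-WL colors over the neighbors of \<open>q\<close> and of \<open>p\<close>. Target links are non-edges,
  so for them the indicator carries no information either.
\<close>

lemma image_mset_eq_iff_rel_mset:
  "image_mset g A = image_mset g' B \<longleftrightarrow> rel_mset (\<lambda>x y. g x = g' y) A B"
  by (simp flip: multiset.rel_eq add: multiset.rel_map)

text \<open>Equality of images is a matching of \<open>A\<close> with \<open>B\<close> along the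
  relation \<open>g x = g' y\<close>, so only this relation on members counts. The colors under
  \<open>g\<close> and \<open>h\<close> may thus have different types.\<close>

lemma image_mset_eq_cong:
  assumes "\<And>x y. x \<in># A \<Longrightarrow> y \<in># B \<Longrightarrow> g x = g' y \<longleftrightarrow> h x = h' y"
  shows "image_mset g A = image_mset g' B \<longleftrightarrow> image_mset h A = image_mset h' B"
  unfolding image_mset_eq_iff_rel_mset
  using assms by (intro multiset.rel_cong refl)

lemma in_mset_set_neighbors_iff:
  "u \<in># mset_set (neighbors G v) \<longleftrightarrow> u \<in> nodes G \<and> (u, v) \<in> edges G"
  by (simp add: neighbors_def nodes_def)

lemma neighbors_eq_out_neighbors:
  assumes "labeled_graph G"
  shows "{v \<in> nodes G. (p, v) \<in> edges G} = neighbors G p"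
  using assms by (auto simp: labeled_graph_def neighbors_def dest: symD)

text \<open>The indicator is kept because the induction passes from a pair, even a non-edge, to
  pairs that are edges.\<close>

lemma wl2_local_eq_iff_wl1_eq:
  fixes G G' :: "'l lgraph"
    and \<iota>\<^sub>1 :: "'l \<Rightarrow> 'c"
    and f\<^sub>1 :: "'c \<times> 'c multiset \<Rightarrow> 'c"
    and \<iota>\<^sub>2 :: "'l \<times> 'l \<times> bool \<Rightarrow> 'd"
    and f\<^sub>2 :: "'d \<times> 'd multiset \<times> 'd multiset \<Rightarrow> 'd"
  assumes inj: "inj \<iota>\<^sub>1" "inj f\<^sub>1" "inj \<iota>\<^sub>2" "inj f\<^sub>2"
    and graphs: "labeled_graph G" "labeled_graph G'"
  shows "wl2_local \<iota>\<^sub>2 f\<^sub>2 G t (p, q) = wl2_local \<iota>\<^sub>2 f\<^sub>2 G' t (p', q') \<longleftrightarrow>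
    wl1 \<iota>\<^sub>1 f\<^sub>1 G t p = wl1 \<iota>\<^sub>1 f\<^sub>1 G' t p' \<and>
    wl1 \<iota>\<^sub>1 f\<^sub>1 G t q = wl1 \<iota>\<^sub>1 f\<^sub>1 G' t q' \<and>
    ((p, q) \<in> edges G \<longleftrightarrow> (p', q') \<in> edges G')"
proof (induction t arbitrary: p q p' q')
  case 0
  show ?case
    using inj by (auto simp: inj_eq)
next
  case (Suc t)
  let ?c = "wl1 \<iota>\<^sub>1 f\<^sub>1 G t" and ?c' = "wl1 \<iota>\<^sub>1 f\<^sub>1 G' t"
  let ?d = "wl2_local \<iota>\<^sub>2 f\<^sub>2 G t" and ?d' = "wl2_local \<iota>\<^sub>2 f\<^sub>2 G' t"
  \<comment> \<open>The shared endpoints agree and both indicators are true, so the induction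
    hypothesis leaves only \<open>?c u = ?c' u'\<close>.\<close>
  have first: "{# ?d (u, q). u \<in># mset_set (neighbors G q) #} =
        {# ?d' (u, q'). u \<in># mset_set (neighbors G' q') #} \<longleftrightarrow>
      {# ?c u. u \<in># mset_set (neighbors G q) #} = {# ?c' u. u \<in># mset_set (neighbors G' q') #}"
    if "?c q = ?c' q'"
    using that
    by (intro image_mset_eq_cong) (auto simp: Suc.IH in_mset_set_neighbors_iff)
  have second: "{# ?d (p, v). v \<in># mset_set (neighbors G p) #} =
        {# ?d' (p', v). v \<in># mset_set (neighbors G' p') #} \<longleftrightarrow>
      {# ?c v. v \<in># mset_set (neighbors G p) #} = {# ?c' v. v \<in># mset_set (neighbors G' p') #}"
    if "?c p = ?c' p'"
    using that graphs
    \<comment> \<open>Symmetry turns the edge \<open>(v, p)\<close> given by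
      \<open>neighbors\<close> into \<open>(p, v)\<close>.\<close>
    by (intro image_mset_eq_cong) (auto simp: Suc.IH in_mset_set_neighbors_iff labeled_graph_def dest: symD)
  show ?case
    \<comment> \<open>Injectivity splits each update; equality of the previous colors supplies the
      premises of \<open>first\<close> and \<open>second\<close>.\<close>
    using inj first second
    by (auto simp: inj_eq Suc.IH neighbors_eq_out_neighbors[OF graphs(1)]
        neighbors_eq_out_neighbors[OF graphs(2)] simp flip: neighbors_def)
qed

theorem theorem4p3:
  fixes G G' :: "'l lgraph"
    and e e' :: "nat \<times> nat"
    and \<iota>\<^sub>1 :: "'l \<Rightarrow> 'c"
    and f\<^sub>1 :: "'c \<times> 'c multiset \<Rightarrow> 'c"
    and \<iota>\<^sub>2 :: "'l \<times> 'l \<times> bool \<Rightarrow> 'd"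
    and f\<^sub>2 :: "'d \<times> 'd multiset \<times> 'd multiset \<Rightarrow> 'd"
  assumes "inj \<iota>\<^sub>1" and "inj f\<^sub>1" and "inj \<iota>\<^sub>2" and "inj f\<^sub>2"
    and "labeled_graph G" and "labeled_graph G'"
    and "e \<in> nodes G \<times> nodes G" and "e' \<in> nodes G' \<times> nodes G'"
    and "e \<notin> edges G" and "e' \<notin> edges G'"
  shows "wl2_local_distinguishes \<iota>\<^sub>2 f\<^sub>2 e G e' G' \<longleftrightarrow> wl1_distinguishes \<iota>\<^sub>1 f\<^sub>1 e G e' G'"
proof -
  obtain p q p' q' where links: "e = (p, q)" "e' = (p', q')"
    by fastforce
  show ?thesis
    \<comment> \<open>Both indicators are false here, so the tests agree round by round.\<close>
    using assms(9,10) wl2_local_eq_iff_wl1_eq[OF assms(1-6)]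
    by (simp add: links wl2_local_distinguishes_def wl1_distinguishes_def)
qed

end
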